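(* Let $K\subset\mathbb{C}$ be a compact set of positive logarithmic capacity such that $\Omega=\overline{\mathbb{C}}\setminus K$ is simply connected, let $z_0\in\Omega$ (the case $z_0=\infty$ is allowed), and let $d\mu=f_{z_0}\,d\omega_{z_0}+d\mu_s$ be a finite positive Borel measure on $K$ with $\mu_s$ singular with respect to $\omega_{z_0}$. Then for every integer $n\ge 0$ and every $0<r<\infty$, $$\lambda_n(\mu,z_0,r)\ \ge\ S(f_{z_0},z_0)\,C(K,z_0)^{nr}.$$
   Context: $\overline{\mathbb{C}}=\mathbb{C}\cup\{\infty\}$ is the Riemann sphere, and $\omega_{z_0}$ is the harmonic measure of the domain $\Omega$ at the point $z_0$ (a probability measure on $\partial\Omega$). Christoffel function: for $z_0\ne\infty$, $\lambda_n(\mu,z_0,r)=\inf\{\int_K|P|^r\,d\mu : P \text{ a polynomial of degree}\le n,\ P(z_0)=1\}$; for $z_0=\infty$, $\lambda_n(\mu,\infty,r)=\inf\{\int_K|P|^r\,d\mu : P \text{ a monic polynomial of degree } n\}$. Conformal map: $\Phi_{z_0}$ is the conformal map from $\Omega$ onto $\overline{\mathbb{C}}\setminus\overline{\mathbb{D}}$ with $\Phi_{z_0}(\infty)=\infty$, normalized by $\Phi_{z_0}(z_0)>0$ if $z_0\neq\infty$ and by $\Phi_\infty'(\infty):=\lim_{z\to\infty}\Phi_\infty(z)/z>0$ if $z_0=\infty$. Set $C(K,z_0)=1/\Phi_{z_0}(z_0)$ if $z_0\ne\infty$ and $C(K,\infty)=1/\Phi_\infty'(\infty)$ (the logarithmic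 capacity of $K$). Entropy integral: $S(f_{z_0},z_0)=\exp\big(\int\log f_{z_0}\,d\omega_{z_0}\big)$ if $\int\log f_{z_0}\,d\omega_{z_0}>-\infty$, and $S(f_{z_0},z_0)=0$ otherwise. *)

theory Defs
  imports "HOL-Complex_Analysis.Complex_Analysis" "HOL-Probability.Probability_Measure"
begin

section \<open>Extended-real preliminaries\<close>

text \<open>Natural logarithm on \<open>[0,\<infinity>)\<close> with \<open>log 0 = -\<infinity>\<close> (the library has \<open>ln 0 = 0\<close>).\<close>

definition elog :: "real \<Rightarrow> ereal" where
  "elog x = (if x \<le> 0 then -\<infinity> else ereal (ln x))"

definition eexp :: "ereal \<Rightarrow> ennreal" where
  "eexp x = (case x of ereal y \<Rightarrow> ennreal (exp y) | PInfty \<Rightarrow> \<infinity> | MInfty \<Rightarrow> 0)"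

text \<open>Integral of the positive part minus integral of the negative part. All functions integrated
  below have a positive part with finite integral, so that \<open>\<infinity> - \<infinity>\<close> does not arise and the value
  lies in \<open>[-\<infinity>,\<infinity>)\<close>.\<close>

definition ereal_integral :: "'a measure \<Rightarrow> ('a \<Rightarrow> ereal) \<Rightarrow> ereal" where
  "ereal_integral M g =
     enn2ereal (\<integral>\<^sup>+ x. e2ennreal (g x) \<partial>M) - enn2ereal (\<integral>\<^sup>+ x. e2ennreal (- g x) \<partial>M)"

definition mutually_singular :: "'a measure \<Rightarrow> 'a measure \<Rightarrow> bool" where
  "mutually_singular M N \<longleftrightarrow>
     (\<exists>A. A \<in> sets M \<and> A \<in> sets N \<and> emeasure M A = 0 \<and> emeasure N (space N - A) = 0)"

section \<open>The Riemann sphere\<close>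

text \<open>\<open>None\<close> is the point at infinity.\<close>

definition riemann_sphere :: "complex option topology" where
  "riemann_sphere = Alexandroff_compactification euclidean"

definition exterior_domain :: "complex set \<Rightarrow> complex option set" where
  "exterior_domain K = - (Some ` K)"

text \<open>The inversion \<open>z \<mapsto> 1/z\<close> of the sphere; \<open>\<lambda>w. sphere_inv (Some w)\<close> is the standard
  parametrization of the sphere near infinity.\<close>

definition sphere_inv :: "complex option \<Rightarrow> complex option" where
  "sphere_inv p = (case p of None \<Rightarrow> Some 0 | Some z \<Rightarrow> if z = 0 then None else Some (1 / z))"

text \<open>The analogue of the library's \<^const>\<open>simply_connected\<close> for abstract topological spaces.\<close>

definition simply_connected_space :: "'a topology \<Rightarrow> bool" where
  "simply_connected_space X \<longleftrightarrow>
     (\<forall>p q. pathin X p \<and> p 1 = p 0 \<and> pathin X q \<and> q 1 = q 0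
        \<longrightarrow> homotopic_with (\<lambda>h. h 1 = h 0) (top_of_set {0..1::real}) X p q)"

section \<open>Logarithmic capacity\<close>

definition log_energy :: "complex measure \<Rightarrow> ereal" where
  "log_energy \<nu> = ereal_integral (\<nu> \<Otimes>\<^sub>M \<nu>) (\<lambda>(z, w). elog (cmod (z - w)))"

definition log_capacity :: "complex set \<Rightarrow> ennreal" where
  "log_capacity K =
     (SUP \<nu> \<in> {\<nu>. prob_space \<nu> \<and> sets \<nu> = sets borel \<and> emeasure \<nu> (- K) = 0}. eexp (log_energy \<nu>))"

section \<open>Subharmonic functions, Perron solutions and harmonic measure\<close>

definition subharmonic_on :: "(complex \<Rightarrow> ereal) \<Rightarrow> complex set \<Rightarrow> bool" where
  "subharmonic_on u V \<longleftrightarrow>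
     (\<forall>z\<in>V. u z < \<infinity>) \<and>
     (\<forall>c. open {z \<in> V. u z < c}) \<and>
     (\<forall>z\<in>V. \<exists>\<rho>>0. ball z \<rho> \<subseteq> V \<and>
        (\<forall>s. 0 < s \<and> s < \<rho> \<longrightarrow>
           u z \<le> ereal (1 / (2 * pi)) *
             ereal_integral (restrict_space lborel {0..2 * pi}) (\<lambda>t. u (z + of_real s * cis t))))"

definition sphere_subharmonic_on :: "(complex option \<Rightarrow> ereal) \<Rightarrow> complex option set \<Rightarrow> bool" where
  "sphere_subharmonic_on u D \<longleftrightarrow>
     subharmonic_on (\<lambda>z. u (Some z)) {z. Some z \<in> D} \<and>
     subharmonic_on (\<lambda>w. u (sphere_inv (Some w))) {w. sphere_inv (Some w) \<in> D}"

text \<open>Perron function of \<open>exterior_domain K\<close> for boundary data \<open>\<phi>\<close>. For compact \<open>K\<close> the point at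
  infinity is interior to the domain, so its boundary in the sphere is \<open>frontier K\<close>.\<close>

definition perron :: "complex set \<Rightarrow> (complex \<Rightarrow> real) \<Rightarrow> complex option \<Rightarrow> ereal" where
  "perron K \<phi> z0 =
     (SUP u \<in> {u. sphere_subharmonic_on u (exterior_domain K) \<and>
                  (\<forall>\<zeta>\<in>frontier K. Limsup (at \<zeta> within - K) (\<lambda>z. u (Some z)) \<le> ereal (\<phi> \<zeta>))}. u z0)"

definition is_harmonic_measure :: "complex set \<Rightarrow> complex option \<Rightarrow> complex measure \<Rightarrow> bool" where
  "is_harmonic_measure K z0 \<omega> \<longleftrightarrow>
     prob_space \<omega> \<and> sets \<omega> = sets borel \<and> emeasure \<omega> (- frontier K) = 0 \<and>
     (\<forall>\<phi>. continuous_on (frontier K) \<phi> \<longrightarrow>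
        perron K \<phi> z0 = ereal (set_lebesgue_integral \<omega> (frontier K) \<phi>))"

section \<open>The normalized conformal map\<close>

text \<open>Injectivity and \<open>\<Phi>(\<infinity>) = \<infinity>\<close> make \<open>\<Phi>\<close> finite at finite points, and \<open>\<Phi>\<close> never vanishes, so
  the two coordinate expressions below do describe \<open>\<Phi>\<close>.\<close>

definition exterior_conformal_map :: "complex set \<Rightarrow> (complex option \<Rightarrow> complex option) \<Rightarrow> bool" where
  "exterior_conformal_map K \<Phi> \<longleftrightarrow>
     bij_betw \<Phi> (exterior_domain K) (exterior_domain (cball 0 1)) \<and> \<Phi> None = None \<and>
     (\<lambda>z. the (\<Phi> (Some z))) holomorphic_on {z. Some z \<in> exterior_domain K} \<and>
     (\<lambda>w. the (sphere_inv (\<Phi> (sphere_inv (Some w)))))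
        holomorphic_on {w. sphere_inv (Some w) \<in> exterior_domain K}"

text \<open>\<open>\<Phi>(z0)\<close> for finite \<open>z0\<close>, and \<open>\<Phi>'(\<infinity>)\<close> for \<open>z0 = \<infinity>\<close>.\<close>

definition normalizing_value :: "(complex option \<Rightarrow> complex option) \<Rightarrow> complex option \<Rightarrow> complex" where
  "normalizing_value \<Phi> z0 =
     (case z0 of Some z \<Rightarrow> the (\<Phi> (Some z))
               | None \<Rightarrow> Lim at_infinity (\<lambda>z. the (\<Phi> (Some z)) / z))"

text \<open>By uniqueness the choice below only affects values outside the domain.\<close>

definition conformal_map :: "complex set \<Rightarrow> complex option \<Rightarrow> complex option \<Rightarrow> complex option" where
  "conformal_map K z0 =
     (SOME \<Phi>. exterior_conformal_map K \<Phi> \<and>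
              Im (normalizing_value \<Phi> z0) = 0 \<and> Re (normalizing_value \<Phi> z0) > 0)"

definition conformal_const :: "complex set \<Rightarrow> complex option \<Rightarrow> real" where
  "conformal_const K z0 = 1 / Re (normalizing_value (conformal_map K z0) z0)"

section \<open>Christoffel functions and the entropy integral\<close>

definition christoffel :: "complex set \<Rightarrow> complex measure \<Rightarrow> complex option \<Rightarrow> nat \<Rightarrow> real \<Rightarrow> real" where
  "christoffel K \<mu> z0 n r =
     (INF P \<in> (case z0 of Some z \<Rightarrow> {P. degree P \<le> n \<and> poly P z = 1}
                        | None \<Rightarrow> {P. degree P = n \<and> lead_coeff P = 1}).
        set_lebesgue_integral \<mu> K (\<lambda>w. cmod (poly P w) powr r))"

definition entropy_integral :: "(complex \<Rightarrow> real) \<Rightarrow> complex measure \<Rightarrow> real" where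
  "entropy_integral f \<omega> =
     (let I = ereal_integral \<omega> (\<lambda>z. elog (f z)) in if I > -\<infinity> then exp (real_of_ereal I) else 0)"

end

theory Submission
  imports Defs
begin

text \<open>
  Let \<open>\<Phi>\<close> be the exterior conformal map, so that \<open>g = log |\<Phi>|\<close> is the Green function of the domain
  \<open>\<Omega>\<close> with pole at infinity. For a polynomial \<open>P\<close> of degree at most \<open>n\<close> the function
  \<open>log |P| - n g\<close> is subharmonic on all of \<open>\<Omega>\<close>: at infinity the growth of \<open>log |P|\<close> is compensated by
  that of \<open>n g\<close>. Its boundary values are at most \<open>log |P|\<close>, because \<open>g\<close> is positive. Since harmonic
  measure is given by suprema over families of subharmonic functions, it follows that the value of
  \<open>log |P| - n g\<close> at \<open>z0\<close> is at most \<open>\<integral> log |P| d\<omega>\<close>. For the polynomials that compete in the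
  Christoffel function this value is exactly \<open>n log C(K, z0)\<close>. Jensen's inequality for the probability
  measure \<open>\<omega>\<close> then gives
  \<open>\<integral> |P|\<^sup>r d\<mu> \<ge> \<integral> |P|\<^sup>r f d\<omega> \<ge> exp (\<integral> log f d\<omega> + r \<integral> log |P| d\<omega>) \<ge> S(f, z0) C(K, z0)\<^sup>n\<^sup>r\<close>.

  The boundary data of a Perron family must be continuous and \<open>log |P|\<close> need not be. It is replaced by
  \<open>log max(|P|, \<epsilon>)\<close>, for which the comparison is \<open>log_quotient_le_integral\<close>; only after Jensen's
  inequality, in \<open>entropy_le_integral_power\<close>, does \<open>\<epsilon>\<close> tend to \<open>0\<close>. In this way the integrability of
  \<open>log |P|\<close> never becomes an issue.

  Subharmonicity is a local question. In each of the two charts of the sphere, \<open>log |P| - n g\<close> is the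
  logarithm of the modulus of one holomorphic function: \<open>P / \<Phi>\<^sup>n\<close> in the plane, and near infinity the
  reversed polynomial times a power of a function without zeros. The required mean value inequality
  is trivial at a zero of such a function, and elsewhere it is the mean value property of the real
  part of a holomorphic logarithm (\<open>subharmonic_on_log_norm\<close>).

  The constant \<open>C(K, z0)\<close> is read off from a chosen conformal map, so it means something only once
  such a map is known to exist (\<open>normalized_conformal_map_exists\<close>). Positive capacity provides two
  points \<open>a \<noteq> b\<close> of \<open>K\<close>. The map \<open>z \<mapsto> 1 / (z - a)\<close> carries \<open>\<Omega>\<close> homeomorphically onto a simply
  connected plane domain that omits \<open>1 / (b - a)\<close>, to which the Riemann mapping theorem applies; a
  rotation takes care of the normalization.
\<close>

section \<open>Coordinates on the sphere and on the domain\<close>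

lemma mem_exterior_domain [simp]:
  "None \<in> exterior_domain K" "Some z \<in> exterior_domain K \<longleftrightarrow> z \<notin> K"
  by (auto simp: exterior_domain_def)

text \<open>For \<open>a \<in> K\<close> the two maps below are mutually inverse between a plane domain and \<open>exterior_domain K\<close>;
  this is how the Riemann mapping theorem for plane domains reaches the sphere. For \<open>a = 0\<close> the first
  one is the chart at infinity in which conformality at infinity is expressed.\<close>

definition sphere_param :: "complex \<Rightarrow> complex \<Rightarrow> complex option" where
  "sphere_param a w = (if w = 0 then None else Some (a + 1 / w))"

definition sphere_coord :: "complex \<Rightarrow> complex option \<Rightarrow> complex" where
  "sphere_coord a p = (case p of None \<Rightarrow> 0 | Some z \<Rightarrow> 1 / (z - a))"

lemma sphere_coord_param [simp]: "sphere_coord a (sphere_param a w) = w"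
  by (simp add: sphere_coord_def sphere_param_def)

lemma sphere_param_coord: "p \<noteq> Some a \<Longrightarrow> sphere_param a (sphere_coord a p) = p"
  by (auto simp: sphere_coord_def sphere_param_def split: option.splits)

lemma sphere_param_0: "sphere_param 0 w = sphere_inv (Some w)"
  by (simp add: sphere_param_def sphere_inv_def)

lemma open_punctured_vimage:
  fixes k :: "complex \<Rightarrow> complex"
  assumes "continuous_on (- {a}) k" "open U"
  shows "open {z. z \<noteq> a \<and> k z \<in> U}"
proof -
  have "{z. z \<noteq> a \<and> k z \<in> U} = (- {a}) \<inter> k -` U" by auto
  then show ?thesis
    by (simp only:) (intro continuous_open_preimage assms, auto)
qed

lemma continuous_map_sphere_param: "continuous_map euclidean riemann_sphere (sphere_param a)"
  unfolding continuous_map_def riemann_sphere_def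
proof (intro conjI allI impI)
  fix U :: "complex option set" assume "openin (Alexandroff_compactification euclidean) U"
  then consider (finite) W where "open W" "U = Some ` W"
    | (infinite) C where "compact C" "U = insert None (Some ` (- C))"
    by (auto simp: openin_Alexandroff_compactification Compl_eq_Diff_UNIV)
  then show "openin euclidean {w \<in> topspace euclidean. sphere_param a w \<in> U}"
  proof cases
    case finite
    have "{w. sphere_param a w \<in> U} = {w. w \<noteq> 0 \<and> a + 1 / w \<in> W}"
      by (auto simp: sphere_param_def finite)
    also have "open \<dots>"
      by (intro open_punctured_vimage continuous_intros) (auto simp: finite)
    finally show ?thesis by simp
  next
    case infinite
    have bdd: "bounded ((\<lambda>z. z - a) ` C)"
      using infinite(1) by (intro compact_imp_bounded compact_continuous_image continuous_intros)
    obtain B where B: "B > 0" "\<And>z. z \<in> C \<Longrightarrow> cmod (z - a) \<le> B"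
      using bdd unfolding bounded_pos by auto
    \<comment> \<open>Of the disc only the centre is missing from the first set; adding all of it makes openness at \<open>0\<close> visible.\<close>
    have "{w. sphere_param a w \<in> U} = {w. w \<noteq> 0 \<and> a + 1 / w \<in> - C} \<union> ball 0 (1 / B)"
    proof (intro equalityI subsetI)
      fix w assume "w \<in> {w. w \<noteq> 0 \<and> a + 1 / w \<in> - C} \<union> ball 0 (1 / B)"
      moreover have "a + 1 / w \<notin> C" if "w \<in> ball 0 (1 / B)" "w \<noteq> 0"
      proof
        assume "a + 1 / w \<in> C"
        then have "1 / cmod w \<le> B" using B(2)[of "a + 1 / w"] by (simp add: norm_divide)
        then show False using that B(1) by (simp add: field_simps)
      qed
      ultimately show "w \<in> {w. sphere_param a w \<in> U}"
        by (auto simp: sphere_param_def infinite)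
    qed (use B(1) in \<open>auto simp: sphere_param_def infinite split: if_splits\<close>)
    also have "open \<dots>"
      using infinite(1)
      by (intro open_Un open_punctured_vimage continuous_intros)
         (auto simp: compact_imp_closed open_Compl)
    finally show ?thesis by simp
  qed
qed (auto simp: notin_range_Some)

lemma continuous_map_sphere_coord:
  "continuous_map (subtopology riemann_sphere (- {Some a})) euclidean (sphere_coord a)"
  unfolding continuous_map_def
proof (intro conjI allI impI)
  fix U :: "complex set" assume "openin euclidean U"
  then have U: "open U" by simp
  have op: "open {z. z \<noteq> a \<and> 1 / (z - a) \<in> U}"
    using U by (intro open_punctured_vimage continuous_intros) auto
  have top: "topspace (subtopology riemann_sphere (- {Some a})) = - {Some a}"
    by (auto simp: riemann_sphere_def notin_range_Some)
  have "openin riemann_sphere {p \<in> - {Some a}. sphere_coord a p \<in> U}"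
  proof (cases "0 \<in> U")
    case False
    have "{p \<in> - {Some a}. sphere_coord a p \<in> U} = Some ` {z. z \<noteq> a \<and> 1 / (z - a) \<in> U}"
      using False by (auto simp: sphere_coord_def image_iff split: option.splits)
    then show ?thesis using op by (simp add: riemann_sphere_def)
  next
    case True
    define C where "C = - {z. z \<noteq> a \<and> 1 / (z - a) \<in> U}"
    have eq: "{p \<in> - {Some a}. sphere_coord a p \<in> U} = insert None (Some ` (UNIV - C))"
    proof (rule set_eqI)
      show "x \<in> {p \<in> - {Some a}. sphere_coord a p \<in> U} \<longleftrightarrow> x \<in> insert None (Some ` (UNIV - C))" for x
        using True by (cases x) (auto simp: C_def sphere_coord_def image_iff)
    qed
    obtain e where e: "e > 0" "ball 0 e \<subseteq> U" using U True by (meson openE)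
    have "C \<subseteq> cball a (1 / e)"
    proof
      fix z assume "z \<in> C"
      then have "z = a \<or> 1 / (z - a) \<notin> ball 0 e" using e by (auto simp: C_def)
      then have "z = a \<or> e \<le> 1 / cmod (z - a)" by (auto simp: norm_divide)
      then have "cmod (z - a) \<le> 1 / e"
        using e(1) le_imp_inverse_le[of e "1 / cmod (z - a)"] by (auto simp: divide_inverse)
      then show "z \<in> cball a (1 / e)"
        by (simp add: dist_norm norm_minus_commute)
    qed
    then have "bounded C" using bounded_cball bounded_subset by blast
    moreover have "closed C" using op by (simp add: C_def closed_Compl)
    ultimately have "compact C" by (simp add: compact_eq_bounded_closed)
    then show ?thesis
      unfolding eq riemann_sphere_def openin_Alexandroff_compactification
      by (intro disjI2 exI[of _ C]) (auto simp: compact_imp_closed)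
  qed
  then show "openin (subtopology riemann_sphere (- {Some a}))
     {p \<in> topspace (subtopology riemann_sphere (- {Some a})). sphere_coord a p \<in> U}"
    unfolding top by (auto simp: openin_subtopology)
qed (auto simp: notin_range_Some)

definition coord_domain :: "complex set \<Rightarrow> complex \<Rightarrow> complex set" where
  "coord_domain K a = {w. sphere_param a w \<in> exterior_domain K}"

lemma mem_coord_domain: "w \<in> coord_domain K a \<longleftrightarrow> w = 0 \<or> a + 1 / w \<notin> K"
  by (auto simp: coord_domain_def sphere_param_def exterior_domain_def)

lemma open_coord_domain:
  assumes "compact K" shows "open (coord_domain K a)"
proof -
  have "openin riemann_sphere (exterior_domain K)"
    unfolding riemann_sphere_def openin_Alexandroff_compactification
  proof (intro disjI2 exI[of _ K] conjI)
    show "exterior_domain K = insert None (Some ` (topspace euclidean - K))"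
    proof (rule set_eqI)
      show "x \<in> exterior_domain K \<longleftrightarrow> x \<in> insert None (Some ` (topspace euclidean - K))" for x
        by (cases x) (auto simp: exterior_domain_def)
    qed
  qed (use assms in \<open>auto simp: compact_imp_closed\<close>)
  then show ?thesis
    using continuous_map_sphere_param[of a]
    unfolding coord_domain_def continuous_map_def by auto
qed

text \<open>Both notions of simple connectedness say that any two loops are freely homotopic, so homotopies can
  be carried over by \<open>sphere_coord a\<close>. As \<open>sphere_coord a \<circ> sphere_param a\<close> is the identity on the
  whole plane, the transported homotopy joins exactly the given loops. The hypothesis \<open>a \<in> K\<close>
  excludes the point at which \<open>sphere_coord a\<close> is discontinuous.\<close>

lemma simply_connected_coord_domain:
  assumes sc: "simply_connected_space (subtopology riemann_sphere (exterior_domain K))" and a: "a \<in> K"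
  shows "simply_connected (coord_domain K a)"
  unfolding simply_connected_def
proof (intro allI impI, elim conjE)
  fix p q
  assume p: "path p" "pathfinish p = pathstart p" "path_image p \<subseteq> coord_domain K a"
    and q: "path q" "pathfinish q = pathstart q" "path_image q \<subseteq> coord_domain K a"
  let ?\<Omega> = "subtopology riemann_sphere (exterior_domain K)"
  have param: "continuous_map (top_of_set (coord_domain K a)) ?\<Omega> (sphere_param a)"
    using continuous_map_from_subtopology[OF continuous_map_sphere_param]
    by (auto simp: continuous_map_in_subtopology coord_domain_def)
  have "exterior_domain K \<subseteq> - {Some a}"
    using a by (auto simp: exterior_domain_def)
  then have "continuous_map ?\<Omega> euclidean (sphere_coord a)"
    using continuous_map_from_subtopology_mono[OF continuous_map_sphere_coord] by blast
  moreover have "sphere_coord a x \<in> coord_domain K a" if "x \<in> exterior_domain K" for x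
  proof -
    have "x \<noteq> Some a" using that a by (auto simp: exterior_domain_def)
    then show ?thesis using that by (simp add: coord_domain_def sphere_param_coord)
  qed
  ultimately have coord: "continuous_map ?\<Omega> (top_of_set (coord_domain K a)) (sphere_coord a)"
    by (auto simp: continuous_map_in_subtopology)
  have lift: "pathin ?\<Omega> (sphere_param a \<circ> c)"
    if "path c" "path_image c \<subseteq> coord_domain K a" for c
    using that param unfolding pathin_def path_def path_image_def
    by (intro continuous_map_compose[of _ "top_of_set (coord_domain K a)"])
       (auto simp: continuous_map_in_subtopology)
  have "homotopic_with (\<lambda>h. h 1 = h 0) (top_of_set {0..1}) ?\<Omega> (sphere_param a \<circ> p) (sphere_param a \<circ> q)"
    using sc lift[OF p(1,3)] lift[OF q(1,3)] p(2) q(2)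
    unfolding simply_connected_space_def by (simp add: pathstart_def pathfinish_def)
  then have "homotopic_with (\<lambda>h. h 1 = h 0) (top_of_set {0..1}) (top_of_set (coord_domain K a))
      (sphere_coord a \<circ> (sphere_param a \<circ> p)) (sphere_coord a \<circ> (sphere_param a \<circ> q))"
    by (rule homotopic_with_compose_continuous_map_left[OF _ coord]) auto
  then show "homotopic_loops (coord_domain K a) p q"
    by (simp add: homotopic_loops_def pathstart_def pathfinish_def o_def)
qed

text \<open>The empty set carries no probability measure, and the point mass, the only one on a singleton, has
  logarithmic energy \<open>-\<infinity>\<close>.\<close>

lemma log_capacity_pos_imp_two_points:
  assumes "log_capacity K > 0"
  obtains a b where "a \<in> K" "b \<in> K" "a \<noteq> b"
proof -
  from assms obtain \<nu> where \<nu>: "prob_space \<nu>" "sets \<nu> = sets borel" "emeasure \<nu> (- K) = 0"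
      "eexp (log_energy \<nu>) > 0"
    unfolding log_capacity_def less_SUP_iff by auto
  interpret prob_space \<nu> by fact
  have space[simp]: "space \<nu> = UNIV" using \<nu>(2) by (simp add: sets_eq_imp_space_eq)
  have "K \<noteq> {}"
    using \<nu>(3) emeasure_space_1 by auto
  moreover have "K \<noteq> {a}" for a
  proof
    assume K: "K = {a}"
    interpret P: pair_prob_space \<nu> \<nu> by unfold_locales
    have m: "{a} \<in> sets \<nu>" "- {a} \<in> sets \<nu>" using \<nu>(2) by auto
    have "emeasure \<nu> {a} = 1"
      using \<nu>(3) m emeasure_compl[of "- {a}" \<nu>] emeasure_space_1 K
      by (simp add: Diff_eq emeasure_eq_measure)
    then have d: "emeasure (\<nu> \<Otimes>\<^sub>M \<nu>) ({a} \<times> {a}) = 1"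
      using emeasure_pair_measure_Times[OF m(1) m(1)] by simp
    have "AE x in \<nu> \<Otimes>\<^sub>M \<nu>. x \<in> {a} \<times> {a}"
      using P.AE_prob_1[of "{a} \<times> {a}"] d by (simp add: P.emeasure_eq_measure)
    then have AE: "AE x in \<nu> \<Otimes>\<^sub>M \<nu>. (case x of (z, w) \<Rightarrow> elog (cmod (z - w))) = - \<infinity>"
      by eventually_elim (auto simp: elog_def)
    have "(\<integral>\<^sup>+ x. e2ennreal (case x of (z, w) \<Rightarrow> elog (cmod (z - w))) \<partial>(\<nu> \<Otimes>\<^sub>M \<nu>)) =
        (\<integral>\<^sup>+ x. 0 \<partial>(\<nu> \<Otimes>\<^sub>M \<nu>))"
      using AE by (intro nn_integral_cong_AE) (auto elim!: eventually_mono simp: e2ennreal_neg)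
    moreover have "(\<integral>\<^sup>+ x. e2ennreal (- (case x of (z, w) \<Rightarrow> elog (cmod (z - w)))) \<partial>(\<nu> \<Otimes>\<^sub>M \<nu>)) =
        (\<integral>\<^sup>+ x. \<infinity> \<partial>(\<nu> \<Otimes>\<^sub>M \<nu>))"
      using AE by (intro nn_integral_cong_AE) (auto elim!: eventually_mono)
    ultimately have "log_energy \<nu> = - \<infinity>"
      by (simp add: log_energy_def ereal_integral_def P.emeasure_space_1 zero_ennreal.rep_eq)
    then show False using \<nu>(4) by (simp add: eexp_def)
  qed
  ultimately show ?thesis using that by blast
qed

section \<open>Exterior conformal maps in the two charts of the sphere\<close>

text \<open>\<open>\<phi>\<close> and \<open>chart\<close> express \<open>\<Phi>\<close> in the two charts of the sphere: \<open>chart w = 1 / \<phi> (1 / w)\<close>, with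
  \<open>chart 0 = 0\<close>. The function \<open>chart_quot\<close> is \<open>chart w / w\<close> with its singularity removed; being
  holomorphic without zeros, it records how \<open>1 / \<Phi>\<close> compares with \<open>1 / z\<close> at infinity.\<close>

locale exterior_conformal =
  fixes K :: "complex set" and \<Phi> :: "complex option \<Rightarrow> complex option"
  assumes compact_K: "compact K" and conformal: "exterior_conformal_map K \<Phi>"
begin

definition \<phi> :: "complex \<Rightarrow> complex" where
  "\<phi> z = the (\<Phi> (Some z))"

definition chart :: "complex \<Rightarrow> complex" where
  "chart w = the (sphere_inv (\<Phi> (sphere_inv (Some w))))"

definition chart_quot :: "complex \<Rightarrow> complex" where
  "chart_quot w = (if w = 0 then deriv chart 0 else chart w / w)"

lemma Phi_Some:
  assumes "z \<notin> K"
  shows "\<Phi> (Some z) = Some (\<phi> z)" "cmod (\<phi> z) > 1"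
proof -
  have bij: "bij_betw \<Phi> (exterior_domain K) (exterior_domain (cball 0 1))" and "\<Phi> None = None"
    using conformal by (auto simp: exterior_conformal_map_def)
  have in_dom: "Some z \<in> exterior_domain K" "None \<in> exterior_domain K"
    using assms by (auto simp: exterior_domain_def)
  then have "\<Phi> (Some z) \<noteq> None"
    using bij_betw_imp_inj_on[OF bij] \<open>\<Phi> None = None\<close> by (metis inj_onD option.distinct(1))
  then show eq: "\<Phi> (Some z) = Some (\<phi> z)"
    by (simp add: \<phi>_def)
  have "Some (\<phi> z) \<in> exterior_domain (cball 0 1)"
    using bij_betwE[OF bij] in_dom(1) eq by metis
  then show "cmod (\<phi> z) > 1"
    by (auto simp: exterior_domain_def)
qed

lemma phi_nonzero: "z \<notin> K \<Longrightarrow> \<phi> z \<noteq> 0"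
  using Phi_Some(2)[of z] by auto

lemma holomorphic_phi: "\<phi> holomorphic_on - K"
proof -
  have "{z. Some z \<in> exterior_domain K} = - K" by (auto simp: exterior_domain_def)
  then show ?thesis
    using conformal unfolding exterior_conformal_map_def \<phi>_def[abs_def] by simp
qed

lemma inj_on_phi: "inj_on \<phi> (- K)"
proof (rule inj_onI)
  fix x y assume "x \<in> - K" "y \<in> - K" "\<phi> x = \<phi> y"
  then have "\<Phi> (Some x) = \<Phi> (Some y)" "Some x \<in> exterior_domain K" "Some y \<in> exterior_domain K"
    by (auto simp: Phi_Some exterior_domain_def)
  then show "x = y"
    using conformal unfolding exterior_conformal_map_def bij_betw_def inj_on_def by blast
qed

lemma chart_0: "chart 0 = 0"
  using conformal by (simp add: chart_def exterior_conformal_map_def sphere_inv_def)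

lemma chart_eq:
  assumes "w \<noteq> 0" "1 / w \<notin> K"
  shows "chart w = 1 / \<phi> (1 / w)"
  using assms Phi_Some(1)[OF assms(2)] phi_nonzero[OF assms(2)]
  by (simp add: chart_def sphere_inv_def)

lemma holomorphic_chart: "chart holomorphic_on coord_domain K 0"
  using conformal
  unfolding exterior_conformal_map_def chart_def[abs_def] coord_domain_def sphere_param_0 by simp

lemma open_chart_domain: "open (coord_domain K 0)"
  using compact_K by (rule open_coord_domain)

lemma chart_nonzero: "w \<in> coord_domain K 0 \<Longrightarrow> w \<noteq> 0 \<Longrightarrow> chart w \<noteq> 0"
  using chart_eq[of w] phi_nonzero[of "1 / w"] by (auto simp: mem_coord_domain)

lemma inj_on_chart: "inj_on chart (coord_domain K 0)"
proof (rule inj_onI)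
  fix x y assume xy: "x \<in> coord_domain K 0" "y \<in> coord_domain K 0" "chart x = chart y"
  show "x = y"
  proof (cases "x = 0 \<or> y = 0")
    case True
    then show ?thesis using xy chart_nonzero chart_0 by metis
  next
    case False
    then have "1 / x \<in> - K" "1 / y \<in> - K" "\<phi> (1 / x) = \<phi> (1 / y)"
      using xy chart_eq[of x] chart_eq[of y] by (auto simp: mem_coord_domain)
    then have "1 / x = 1 / y" using inj_on_phi by (metis inj_onD)
    then show ?thesis by simp
  qed
qed

lemma zero_in_chart_domain: "0 \<in> coord_domain K 0"
  by (simp add: mem_coord_domain)

lemma deriv_chart_nonzero: "deriv chart 0 \<noteq> 0"
  using holomorphic_injective_imp_regular[OF holomorphic_chart open_chart_domain inj_on_chart
      zero_in_chart_domain] .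

lemma holomorphic_chart_quot: "chart_quot holomorphic_on coord_domain K 0"
  by (rule pole_theorem_open_0[OF holomorphic_chart open_chart_domain, where a = 0])
     (auto simp: chart_quot_def chart_0)

lemma chart_quot_eq: "z \<noteq> 0 \<Longrightarrow> z \<notin> K \<Longrightarrow> chart_quot (1 / z) = z / \<phi> z"
  by (simp add: chart_quot_def chart_eq)

text \<open>For large \<open>z\<close> the quotient \<open>\<phi> z / z\<close> is \<open>1 / chart_quot (1 / z)\<close>, so the limit defining \<open>\<Phi>'(\<infinity>)\<close>
  is a value of a continuous function.\<close>

lemma normalizing_value_None: "normalizing_value \<Phi> None = 1 / deriv chart 0"
proof -
  have "isCont chart_quot 0"
    using holomorphic_on_imp_continuous_on[OF holomorphic_chart_quot]
      open_chart_domain zero_in_chart_domain by (simp add: continuous_on_eq_continuous_at)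
  then have "((\<lambda>z. chart_quot (inverse z)) \<longlongrightarrow> chart_quot 0) at_infinity"
    by (rule isCont_tendsto_compose) (rule tendsto_inverse_0)
  then have "((\<lambda>z. inverse (chart_quot (inverse z))) \<longlongrightarrow> inverse (chart_quot 0)) at_infinity"
    by (rule tendsto_inverse) (simp add: chart_quot_def deriv_chart_nonzero)
  moreover have "\<forall>\<^sub>F z in at_infinity. inverse (chart_quot (inverse z)) = \<phi> z / z"
  proof -
    obtain B where B: "\<And>z. z \<in> K \<Longrightarrow> cmod z \<le> B"
      using compact_imp_bounded[OF compact_K] unfolding bounded_iff by auto
    show ?thesis
      unfolding eventually_at_infinity
    proof (intro exI[of _ "max B 0 + 1"] allI impI)
      fix z assume z: "max B 0 + 1 \<le> cmod z"
      then have "z \<noteq> 0" "z \<notin> K" using B[of z] by auto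
      then show "inverse (chart_quot (inverse z)) = \<phi> z / z"
        using chart_quot_eq[of z] by (simp add: inverse_eq_divide)
    qed
  qed
  ultimately have "((\<lambda>z. \<phi> z / z) \<longlongrightarrow> inverse (chart_quot 0)) at_infinity"
    by (rule Lim_transform_eventually)
  then have "Lim at_infinity (\<lambda>z. \<phi> z / z) = inverse (chart_quot 0)"
    by (intro tendsto_Lim) (auto simp: trivial_limit_at_infinity)
  then show ?thesis
    by (simp add: normalizing_value_def \<phi>_def chart_quot_def inverse_eq_divide)
qed

lemma normalizing_value_Some: "normalizing_value \<Phi> (Some z) = \<phi> z"
  by (simp add: normalizing_value_def \<phi>_def)

end

section \<open>Existence of the normalized exterior conformal map\<close>

text \<open>The second point \<open>b\<close> ensures that the domain is not the whole plane, the case left out by the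
  Riemann mapping theorem. A disc automorphism then moves the image of \<open>0\<close>, that is of the point at
  infinity, to \<open>0\<close>.\<close>

lemma coord_domain_disc_map:
  assumes "compact K" and sc: "simply_connected_space (subtopology riemann_sphere (exterior_domain K))"
    and ab: "a \<in> K" "b \<in> K" "a \<noteq> b"
  obtains m where "m holomorphic_on coord_domain K a" "bij_betw m (coord_domain K a) (ball 0 1)" "m 0 = 0"
proof -
  let ?V = "coord_domain K a"
  have "0 \<in> ?V" "1 / (b - a) \<notin> ?V"
    using ab by (auto simp: mem_coord_domain)
  then have "?V \<noteq> {}" "?V \<noteq> UNIV" by auto
  then obtain f g where f: "f holomorphic_on ?V" "\<And>z. z \<in> ?V \<Longrightarrow> f z \<in> ball 0 1 \<and> g (f z) = z"
      and g: "\<And>z. z \<in> ball 0 1 \<Longrightarrow> g z \<in> ?V \<and> f (g z) = z"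
    using simply_connected_eq_biholomorphic_to_disc[OF open_coord_domain[OF \<open>compact K\<close>, of a]]
      simply_connected_coord_domain[OF sc ab(1)] by metis
  obtain k l where kl: "k (f 0) = 0" "k holomorphic_on ball 0 1" "k ` ball 0 1 \<subseteq> ball 0 1"
      "l ` ball 0 1 \<subseteq> ball 0 1" "\<And>z. z \<in> ball 0 1 \<Longrightarrow> k (l z) = z" "\<And>z. z \<in> ball 0 1 \<Longrightarrow> l (k z) = z"
    using ball_biholomorphism_exists[of "f 0"] f(2)[OF \<open>0 \<in> ?V\<close>] by metis
  have "(k \<circ> f) holomorphic_on ?V"
    using f kl by (intro holomorphic_on_compose_gen[OF f(1) kl(2)]) auto
  moreover have "bij_betw k (ball 0 1) (ball 0 1)"
    using kl by (intro bij_betwI[of _ _ _ l]) auto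
  then have "bij_betw (k \<circ> f) ?V (ball 0 1)"
    using f g by (intro bij_betw_trans[OF bij_betwI[of f _ _ g]]) auto
  ultimately show ?thesis
    using that[of "k \<circ> f"] kl(1) by simp
qed

text \<open>The chart at infinity of the resulting map is holomorphic because
  \<open>sphere_coord a (1 / w) = w / (1 - a w)\<close>, which for \<open>a \<noteq> 0\<close> has its only pole at \<open>w = 1 / a\<close>,
  the coordinate of the point \<open>a\<close> of \<open>K\<close>.\<close>

lemma exterior_conformal_map_of_disc_map:
  assumes m: "m holomorphic_on coord_domain K a" "bij_betw m (coord_domain K a) (ball 0 1)" "m 0 = 0"
    and a: "a \<in> K"
  defines "\<Phi> \<equiv> \<lambda>p. sphere_param 0 (m (sphere_coord a p))"
  shows "exterior_conformal_map K \<Phi>"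
    and "\<And>z. z \<notin> K \<Longrightarrow> the (\<Phi> (Some z)) = 1 / m (1 / (z - a))"
    and "\<And>w. the (sphere_inv (\<Phi> (sphere_inv (Some w)))) = m (w / (1 - a * w))"
proof -
  have inv_param: "the (sphere_inv (sphere_param 0 w)) = w" for w
    by (auto simp: sphere_param_def sphere_inv_def)
  have Omega: "p \<noteq> Some a" if "p \<in> exterior_domain K" for p
    using that a by (auto simp: exterior_domain_def)
  have coord_in: "sphere_coord a p \<in> coord_domain K a" if "p \<in> exterior_domain K" for p
    using that by (simp add: coord_domain_def sphere_param_coord Omega)
  have b1: "bij_betw (sphere_coord a) (exterior_domain K) (coord_domain K a)"
    by (intro bij_betwI[of _ _ _ "sphere_param a"])
       (auto simp: coord_in sphere_param_coord Omega coord_domain_def)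
  have b3: "bij_betw (sphere_param 0) (ball 0 1) (exterior_domain (cball 0 1))"
  proof (intro bij_betwI[of _ _ _ "sphere_coord 0"])
    show "sphere_param 0 \<in> ball 0 1 \<rightarrow> exterior_domain (cball 0 1)"
      by (auto simp: sphere_param_def exterior_domain_def norm_divide divide_le_eq_1 split: if_splits)
    show "sphere_coord 0 \<in> exterior_domain (cball 0 1) \<rightarrow> ball 0 1"
      by (auto simp: sphere_coord_def norm_divide divide_less_eq_1 split: option.splits)
    show "sphere_param 0 (sphere_coord 0 y) = y" if "y \<in> exterior_domain (cball 0 1)" for y
      using that by (intro sphere_param_coord) (auto simp: exterior_domain_def)
  qed auto
  have bij: "bij_betw \<Phi> (exterior_domain K) (exterior_domain (cball 0 1))"
    using bij_betw_trans[OF bij_betw_trans[OF b1 m(2)] b3] by (simp add: \<Phi>_def o_def)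
  have m_nz: "m x \<noteq> 0" if "x \<in> coord_domain K a" "x \<noteq> 0" for x
    using that m(3) bij_betw_imp_inj_on[OF m(2)] by (metis inj_onD mem_coord_domain)
  have fin: "the (\<Phi> (Some z)) = 1 / m (1 / (z - a)) \<and> m (1 / (z - a)) \<noteq> 0
      \<and> 1 / (z - a) \<in> coord_domain K a \<and> z \<noteq> a" if "z \<notin> K" for z
  proof -
    have "1 / (z - a) \<in> coord_domain K a" "z \<noteq> a" using that a by (auto simp: mem_coord_domain)
    then show ?thesis
      using m_nz[of "1 / (z - a)"] by (simp add: \<Phi>_def sphere_param_def sphere_coord_def)
  qed
  show "the (\<Phi> (Some z)) = 1 / m (1 / (z - a))" if "z \<notin> K" for z
    using fin[OF that] by simp
  have coord_inv: "sphere_coord a (sphere_inv (Some w)) = w / (1 - a * w)" for w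
    by (auto simp: sphere_coord_def sphere_inv_def field_simps)
  show inf: "the (sphere_inv (\<Phi> (sphere_inv (Some w)))) = m (w / (1 - a * w))" for w
    by (simp add: \<Phi>_def inv_param coord_inv)
  show "exterior_conformal_map K \<Phi>"
    unfolding exterior_conformal_map_def inf
  proof (intro conjI bij)
    show "\<Phi> None = None" by (simp add: \<Phi>_def sphere_coord_def sphere_param_def m(3))
    have "{z. Some z \<in> exterior_domain K} = - K" by (auto simp: exterior_domain_def)
    moreover have "(\<lambda>z. 1 / m (1 / (z - a))) holomorphic_on - K"
      using fin
      by (intro holomorphic_intros holomorphic_on_compose_gen[OF _ m(1), unfolded o_def]) auto
    ultimately show "(\<lambda>z. the (\<Phi> (Some z))) holomorphic_on {z. Some z \<in> exterior_domain K}"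
      using fin by (auto intro: holomorphic_transform)
    have "1 - a * w \<noteq> 0" "w / (1 - a * w) \<in> coord_domain K a"
      if "sphere_inv (Some w) \<in> exterior_domain K" for w
    proof -
      show "1 - a * w \<noteq> 0"
      proof
        assume "1 - a * w = 0"
        then have "w \<noteq> 0" by auto
        with \<open>1 - a * w = 0\<close> have "1 / w = a" by (simp add: field_simps)
        with \<open>w \<noteq> 0\<close> show False using Omega[OF that] by (simp add: sphere_inv_def)
      qed
      show "w / (1 - a * w) \<in> coord_domain K a"
        using coord_in[OF that] by (simp add: coord_inv)
    qed
    then show "(\<lambda>w. m (w / (1 - a * w))) holomorphic_on {w. sphere_inv (Some w) \<in> exterior_domain K}"
      by (intro holomorphic_on_compose_gen[OF _ m(1), unfolded o_def] holomorphic_intros) auto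
  qed
qed

text \<open>Multiplying the disc map by a unimodular \<open>c\<close> divides the normalizing value by \<open>c\<close>, both at finite
  points and at infinity, so a suitable \<open>c\<close> makes it positive.\<close>

lemma normalized_conformal_map_exists:
  assumes "compact K" and "log_capacity K > 0"
    and sc: "simply_connected_space (subtopology riemann_sphere (exterior_domain K))"
    and z0: "z0 \<in> exterior_domain K"
  shows "\<exists>\<Phi>. exterior_conformal_map K \<Phi> \<and> Im (normalizing_value \<Phi> z0) = 0 \<and> Re (normalizing_value \<Phi> z0) > 0"
proof -
  obtain a b where ab: "a \<in> K" "b \<in> K" "a \<noteq> b"
    using log_capacity_pos_imp_two_points[OF assms(2)] .
  obtain m where m: "m holomorphic_on coord_domain K a"
      "bij_betw m (coord_domain K a) (ball 0 1)" "m 0 = 0"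
    using coord_domain_disc_map[OF assms(1) sc ab] .
  define \<Psi> where "\<Psi> c p = sphere_param 0 (c * m (sphere_coord a p))" for c p
  have rot: "(\<lambda>w. c * m w) holomorphic_on coord_domain K a"
      "bij_betw (\<lambda>w. c * m w) (coord_domain K a) (ball 0 1)" "c * m 0 = 0" if "cmod c = 1" for c
  proof -
    have "c \<noteq> 0" using that by auto
    then have "bij_betw ((*) c) (ball 0 1) (ball 0 1)"
      using that by (intro bij_betwI[of _ _ _ "\<lambda>w. w / c"]) (auto simp: norm_mult norm_divide)
    then show "bij_betw (\<lambda>w. c * m w) (coord_domain K a) (ball 0 1)"
      using bij_betw_trans[OF m(2)] by (simp add: o_def)
  qed (use m in \<open>auto intro!: holomorphic_intros\<close>)
  have \<Psi>: "exterior_conformal_map K (\<Psi> c)"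
      "\<And>z. z \<notin> K \<Longrightarrow> the (\<Psi> c (Some z)) = 1 / (c * m (1 / (z - a)))"
      "\<And>w. the (sphere_inv (\<Psi> c (sphere_inv (Some w)))) = c * m (w / (1 - a * w))"
    if "cmod c = 1" for c
    by (fact exterior_conformal_map_of_disc_map[OF rot[OF that] ab(1), folded \<Psi>_def])+
  define v where "v = 1 / normalizing_value (\<Psi> 1) z0"
  have v: "v \<noteq> 0 \<and> (\<forall>c. cmod c = 1 \<longrightarrow> normalizing_value (\<Psi> c) z0 = 1 / (c * v))"
  proof (cases z0)
    case None
    interpret exterior_conformal K "\<Psi> 1"
      using \<Psi>(1)[of 1] assms(1) by unfold_locales auto
    have val: "normalizing_value (\<Psi> c) None = 1 / (c * deriv chart 0)" if c: "cmod c = 1" for c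
    proof -
      interpret c: exterior_conformal K "\<Psi> c"
        using \<Psi>(1)[OF c] assms(1) by unfold_locales
      have "c.chart = (\<lambda>w. c * chart w)"
        using \<Psi>(3)[OF c] \<Psi>(3)[of 1] by (auto simp: c.chart_def chart_def)
      moreover have "chart field_differentiable at 0"
        using holomorphic_chart open_chart_domain zero_in_chart_domain
          holomorphic_on_imp_differentiable_at by blast
      ultimately have "deriv c.chart 0 = c * deriv chart 0"
        by (simp add: deriv_cmult)
      then show ?thesis by (simp add: c.normalizing_value_None)
    qed
    then show ?thesis
      using val[of 1] deriv_chart_nonzero by (simp add: None v_def)
  next
    case (Some z)
    interpret exterior_conformal K "\<Psi> 1"
      using \<Psi>(1)[of 1] assms(1) by unfold_locales auto
    have z: "z \<notin> K" using z0 Some by (auto simp: exterior_domain_def)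
    have val: "normalizing_value (\<Psi> c) z0 = 1 / (c * m (1 / (z - a)))" if "cmod c = 1" for c
      using \<Psi>(2)[OF that z] by (simp add: Some normalizing_value_def)
    then show ?thesis
      using val[of 1] phi_nonzero[OF z] by (auto simp: v_def Some normalizing_value_Some)
  qed
  \<comment> \<open>The rotation for which \<open>c * v = |v|\<close>.\<close>
  define c where "c = of_real (cmod v) / v"
  have "cmod c = 1" "c * v = of_real (cmod v)" using v by (auto simp: c_def norm_divide)
  then have "exterior_conformal_map K (\<Psi> c)" "normalizing_value (\<Psi> c) z0 = of_real (1 / cmod v)"
    using \<Psi>(1)[of c] v \<open>cmod c = 1\<close> by auto
  then show ?thesis
    using v by (intro exI[of _ "\<Psi> c"]) simp
qed

section \<open>The logarithm of the modulus of a holomorphic function\<close>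

lemma ereal_integral_ereal:
  assumes "integrable M g"
  shows "ereal_integral M (\<lambda>x. ereal (g x)) = ereal (integral\<^sup>L M g)"
proof -
  have fin: "(\<integral>\<^sup>+x. ennreal (g x) \<partial>M) < \<infinity>" "(\<integral>\<^sup>+x. ennreal (- g x) \<partial>M) < \<infinity>"
    using assms by (auto simp: real_integrable_def less_top[symmetric])
  then obtain a b where ab: "(\<integral>\<^sup>+x. ennreal (g x) \<partial>M) = ennreal a" "0 \<le> a"
      "(\<integral>\<^sup>+x. ennreal (- g x) \<partial>M) = ennreal b" "0 \<le> b"
    by (metis ennreal_cases infinity_ennreal_def less_irrefl)
  show ?thesis
    unfolding ereal_integral_def real_lebesgue_integral_def[OF assms]
    using ab by simp
qed

lemma ereal_integral_cong:
  assumes "\<And>x. x \<in> space M \<Longrightarrow> g x = h x"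
  shows "ereal_integral M g = ereal_integral M h"
  unfolding ereal_integral_def using assms by (auto cong: nn_integral_cong)

lemma subharmonic_on_cong:
  assumes u: "subharmonic_on u V" and eq: "\<And>z. z \<in> V \<Longrightarrow> u z = v z"
  shows "subharmonic_on v V"
  unfolding subharmonic_on_def
proof (intro conjI ballI allI)
  show "v z < \<infinity>" if "z \<in> V" for z
    using u that eq unfolding subharmonic_on_def by metis
  have "{z \<in> V. v z < c} = {z \<in> V. u z < c}" for c
    using eq by auto
  then show "open {z \<in> V. v z < c}" for c
    using u unfolding subharmonic_on_def by simp
  fix z assume z: "z \<in> V"
  obtain \<rho> where \<rho>: "\<rho> > 0" "ball z \<rho> \<subseteq> V" "\<And>s. 0 < s \<Longrightarrow> s < \<rho> \<Longrightarrow>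
      u z \<le> ereal (1 / (2 * pi)) *
        ereal_integral (restrict_space lborel {0..2 * pi}) (\<lambda>t. u (z + of_real s * cis t))"
    using u z unfolding subharmonic_on_def by blast
  have "v z \<le> ereal (1 / (2 * pi)) *
        ereal_integral (restrict_space lborel {0..2 * pi}) (\<lambda>t. v (z + of_real s * cis t))"
    if s: "0 < s" "s < \<rho>" for s
  proof -
    have "z + of_real s * cis t \<in> V" for t
      using \<rho>(2) s by (intro subsetD[OF \<rho>(2)]) (simp add: dist_norm norm_mult)
    then show ?thesis
      using \<rho>(3)[OF s] eq z by simp
  qed
  then show "\<exists>\<rho>>0. ball z \<rho> \<subseteq> V \<and> (\<forall>s. 0 < s \<and> s < \<rho> \<longrightarrow>
           v z \<le> ereal (1 / (2 * pi)) *
             ereal_integral (restrict_space lborel {0..2 * pi}) (\<lambda>t. v (z + of_real s * cis t)))"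
    using \<rho>(1,2) by blast
qed

text \<open>Cauchy's integral formula at the centre: on the circle \<open>u - z = s cis t\<close>, which cancels against the
  derivative \<open>\<i> s cis t\<close> of the parametrization.\<close>

lemma circle_mean_value_Re:
  assumes hol: "G holomorphic_on ball z \<rho>" and s: "0 < s" "s < \<rho>"
  shows "((\<lambda>t. Re (G (z + of_real s * cis t))) has_integral 2 * pi * Re (G z)) {0..2 * pi}"
proof -
  have "((\<lambda>u. G u / (u - z)) has_contour_integral (2 * of_real pi * \<i> * G z)) (circlepath z s)"
    using s by (intro Cauchy_integral_circlepath)
      (auto intro!: holomorphic_on_imp_continuous_on holomorphic_on_subset[OF hol])
  then have "((\<lambda>t. G (z + s * cis t) / (z + s * cis t - z) * s * \<i> * cis t)
      has_integral (2 * of_real pi * \<i> * G z)) {0..2*pi}"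
    unfolding circlepath_def by (subst (asm) has_contour_integral_part_circlepath_iff) auto
  then have "((\<lambda>t. \<i> * G (z + s * cis t)) has_integral (2 * of_real pi * \<i> * G z)) {0..2*pi}"
    using s by (simp add: field_simps)
  then have "((\<lambda>t. - \<i> * (\<i> * G (z + s * cis t))) has_integral - \<i> * (2 * of_real pi * \<i> * G z)) {0..2*pi}"
    by (rule has_integral_mult_right)
  then have "((\<lambda>t. G (z + s * cis t)) has_integral (2 * of_real pi * G z)) {0..2*pi}"
    by (simp add: algebra_simps)
  from has_integral_linear[OF this bounded_linear_Re] show ?thesis
    by (simp add: o_def)
qed

text \<open>At a zero of \<open>F\<close> the left-hand side of the mean value inequality is \<open>-\<infinity>\<close>. Around any other point
  \<open>F = exp G\<close> on a small disc, so \<open>log |F| = Re G\<close> there and equality holds.\<close>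

lemma subharmonic_on_log_norm:
  assumes "open V" and hol: "F holomorphic_on V"
  shows "subharmonic_on (\<lambda>z. elog (cmod (F z))) V"
  unfolding subharmonic_on_def
proof (intro conjI ballI allI)
  show "elog (cmod (F z)) < \<infinity>" for z
    by (simp add: elog_def)
next
  fix c :: ereal
  have cont: "continuous_on V (\<lambda>z. cmod (F z))"
    using hol by (intro continuous_intros holomorphic_on_imp_continuous_on)
  show "open {z \<in> V. elog (cmod (F z)) < c}"
  proof (cases c)
    case (real x)
    have "elog t < c \<longleftrightarrow> t < exp x" if "t \<ge> 0" for t :: real
    proof (cases "t = 0")
      case False
      then show ?thesis
        using that exp_less_cancel_iff[of "ln t" x] real by (auto simp: elog_def)
    qed (use real in \<open>auto simp: elog_def\<close>)
    then have "{z \<in> V. elog (cmod (F z)) < c} = V \<inter> (\<lambda>z. cmod (F z)) -` {..<exp x}"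
      by auto
    then show ?thesis
      using continuous_open_preimage[OF cont \<open>open V\<close> open_lessThan] by simp
  next
    case PInf
    then have "{z \<in> V. elog (cmod (F z)) < c} = V" by (auto simp: elog_def)
    then show ?thesis using \<open>open V\<close> by simp
  next
    case MInf
    then show ?thesis by simp
  qed
next
  fix z assume z: "z \<in> V"
  show "\<exists>\<rho>>0. ball z \<rho> \<subseteq> V \<and> (\<forall>s. 0 < s \<and> s < \<rho> \<longrightarrow>
           elog (cmod (F z)) \<le> ereal (1 / (2 * pi)) *
             ereal_integral (restrict_space lborel {0..2 * pi})
               (\<lambda>t. elog (cmod (F (z + of_real s * cis t)))))"
  proof (cases "F z = 0")
    case True
    then show ?thesis
      using \<open>open V\<close> z by (auto simp: elog_def open_contains_ball)
  next
    case False
    have "open (V \<inter> F -` (- {0}))"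
      using hol \<open>open V\<close> by (intro continuous_open_preimage holomorphic_on_imp_continuous_on) auto
    moreover have "z \<in> V \<inter> F -` (- {0})"
      using z False by auto
    ultimately obtain \<rho> where \<rho>: "\<rho> > 0" "ball z \<rho> \<subseteq> V \<inter> F -` (- {0})"
      by (meson openE)
    have "F holomorphic_on ball z \<rho>"
      using hol \<rho>(2) by (auto intro: holomorphic_on_subset)
    moreover have "F w \<noteq> 0" if "w \<in> ball z \<rho>" for w
      using \<rho>(2) that by auto
    ultimately obtain G where G: "G holomorphic_on ball z \<rho>" "\<And>w. w \<in> ball z \<rho> \<Longrightarrow> F w = exp (G w)"
      using simply_connected_eq_holomorphic_log[of "ball z \<rho>"]
      by (metis convex_ball convex_imp_simply_connected open_ball)
    have elogF: "elog (cmod (F w)) = ereal (Re (G w))" if "w \<in> ball z \<rho>" for w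
      using G(2)[OF that] by (simp add: elog_def not_le)
    have "elog (cmod (F z)) \<le> ereal (1 / (2 * pi)) *
             ereal_integral (restrict_space lborel {0..2 * pi})
               (\<lambda>t. elog (cmod (F (z + of_real s * cis t))))" if s: "0 < s" "s < \<rho>" for s
    proof -
      define k where "k = (\<lambda>t. Re (G (z + of_real s * cis t)))"
      have on: "z + of_real s * cis t \<in> ball z \<rho>" for t
        using s by (simp add: dist_norm norm_mult)
      have "continuous_on {0..2*pi} k"
        unfolding k_def
        by (intro continuous_intros continuous_on_compose2[OF holomorphic_on_imp_continuous_on[OF G(1)]])
           (use on in auto)
      then have int: "set_integrable lborel {0..2*pi} k"
        by (rule borel_integrable_atLeastAtMost')
      have "integral {0..2*pi} k = 2 * pi * Re (G z)"
        using circle_mean_value_Re[OF G(1) s] unfolding k_def by (rule integral_unique)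
      then have "(LINT t|restrict_space lborel {0..2*pi}. k t) = 2 * pi * Re (G z)"
        using set_borel_integral_eq_integral(2)[OF int]
        by (simp add: integral_restrict_space set_lebesgue_integral_def)
      moreover have "integrable (restrict_space lborel {0..2*pi}) k"
        using int by (simp add: integrable_restrict_space set_integrable_def)
      ultimately have "ereal_integral (restrict_space lborel {0..2*pi}) (\<lambda>t. ereal (k t))
          = ereal (2 * pi * Re (G z))"
        by (simp add: ereal_integral_ereal)
      moreover have "ereal_integral (restrict_space lborel {0..2*pi})
           (\<lambda>t. elog (cmod (F (z + of_real s * cis t)))) =
          ereal_integral (restrict_space lborel {0..2*pi}) (\<lambda>t. ereal (k t))"
        using elogF[OF on] by (intro ereal_integral_cong) (simp add: k_def)
      moreover have "elog (cmod (F z)) = ereal (Re (G z))"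
        using elogF[of z] \<rho>(1) by simp
      ultimately show ?thesis
        by simp
    qed
    then show ?thesis
      using \<rho> by auto
  qed
qed

section \<open>Comparison with the Perron solution\<close>

context exterior_conformal
begin

text \<open>This is \<open>log |P| - n log |\<Phi>|\<close>; the value at infinity is its limit.\<close>

definition log_quotient :: "complex poly \<Rightarrow> nat \<Rightarrow> complex option \<Rightarrow> ereal" where
  "log_quotient P n p = (case p of
     None \<Rightarrow> elog (cmod (coeff P n * deriv chart 0 ^ n))
   | Some z \<Rightarrow> elog (cmod (poly P z / \<phi> z ^ n)))"

text \<open>In the chart at infinity \<open>P (1 / w) / \<Phi> (1 / w)\<^sup>n = P (1 / w) chart(w)\<^sup>n = Q(w) (chart(w) / w)\<^sup>n\<close>,
  where \<open>Q(w) = w\<^sup>n P (1 / w)\<close> is again a polynomial because the degree of \<open>P\<close> is at most \<open>n\<close>.\<close>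

lemma sphere_subharmonic_log_quotient:
  assumes "degree P \<le> n"
  shows "sphere_subharmonic_on (log_quotient P n) (exterior_domain K)"
  unfolding sphere_subharmonic_on_def
proof
  have "{z. Some z \<in> exterior_domain K} = - K" by (auto simp: exterior_domain_def)
  moreover have "subharmonic_on (\<lambda>z. elog (cmod (poly P z / \<phi> z ^ n))) (- K)"
    using compact_K phi_nonzero
    by (intro subharmonic_on_log_norm holomorphic_intros holomorphic_phi open_Compl)
       (auto simp: compact_imp_closed)
  ultimately show "subharmonic_on (\<lambda>z. log_quotient P n (Some z)) {z. Some z \<in> exterior_domain K}"
    by (simp add: log_quotient_def)
next
  define Q where "Q w = (\<Sum>i\<le>n. coeff P i * w ^ (n - i))" for w
  have Q0: "Q 0 = coeff P n"
  proof -
    have "Q 0 = (\<Sum>i\<le>n. if i = n then coeff P n else 0)"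
      unfolding Q_def by (intro sum.cong) (auto simp: power_0_left)
    then show ?thesis by simp
  qed
  have Q: "Q w = w ^ n * poly P (1 / w)" if "w \<noteq> 0" for w
  proof -
    have "poly P (1 / w) = (\<Sum>i\<le>n. coeff P i * (1 / w) ^ i)"
      unfolding poly_altdef using assms
      by (intro sum.mono_neutral_left) (auto simp: coeff_eq_0 not_le)
    then show ?thesis
      using that by (auto simp: Q_def sum_distrib_left power_diff field_simps intro!: sum.cong)
  qed
  have dom: "{w. sphere_inv (Some w) \<in> exterior_domain K} = coord_domain K 0"
    by (simp add: coord_domain_def sphere_param_0)
  have eq: "log_quotient P n (sphere_inv (Some w)) = elog (cmod (Q w * chart_quot w ^ n))"
    if w: "w \<in> coord_domain K 0" for w
  proof (cases "w = 0")
    case True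
    then show ?thesis by (simp add: log_quotient_def sphere_inv_def Q0 chart_quot_def)
  next
    case False
    then have "1 / w \<notin> K" using w by (simp add: mem_coord_domain)
    then have "Q w * chart_quot w ^ n = poly P (1 / w) / \<phi> (1 / w) ^ n"
      using False by (simp add: Q chart_quot_def chart_eq power_divide power_mult_distrib)
    then show ?thesis using False by (simp add: log_quotient_def sphere_inv_def)
  qed
  have "Q holomorphic_on coord_domain K 0"
    unfolding Q_def by (intro holomorphic_intros)
  then have "subharmonic_on (\<lambda>w. elog (cmod (Q w * chart_quot w ^ n))) (coord_domain K 0)"
    by (intro subharmonic_on_log_norm open_chart_domain holomorphic_intros holomorphic_chart_quot)
  then show "subharmonic_on (\<lambda>w. log_quotient P n (sphere_inv (Some w)))
      {w. sphere_inv (Some w) \<in> exterior_domain K}"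
    unfolding dom by (rule subharmonic_on_cong) (simp add: eq)
qed

text \<open>Since \<open>|\<Phi>| > 1\<close>, the subharmonic function \<open>log |P| - n log |\<Phi>|\<close> stays below the continuous function
  \<open>log max(|P|, \<epsilon>)\<close> and therefore belongs to the Perron family of the latter.\<close>

lemma log_quotient_le_integral:
  assumes "degree P \<le> n" "is_harmonic_measure K z0 \<omega>" "\<epsilon> > 0"
  shows "log_quotient P n z0 \<le>
    ereal (set_lebesgue_integral \<omega> (frontier K) (\<lambda>z. ln (max (cmod (poly P z)) \<epsilon>)))"
proof -
  define b where "b z = ln (max (cmod (poly P z)) \<epsilon>)" for z
  have contb: "continuous_on UNIV b"
    unfolding b_def using \<open>\<epsilon> > 0\<close> by (intro continuous_intros) (auto simp: max_def)
  have "Limsup (at \<zeta> within - K) (\<lambda>z. log_quotient P n (Some z)) \<le> ereal (b \<zeta>)" for \<zeta>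
  proof (cases "at \<zeta> within - K = bot")
    case True
    then show ?thesis by simp
  next
    case False
    have "log_quotient P n (Some z) \<le> ereal (b z)" if "z \<notin> K" for z
    proof (cases "poly P z = 0")
      case True
      then show ?thesis by (simp add: log_quotient_def elog_def)
    next
      case nz: False
      have "1 \<le> cmod (\<phi> z) ^ n"
        using Phi_Some(2)[OF that] by (intro one_le_power) simp
      then have "cmod (poly P z / \<phi> z ^ n) \<le> cmod (poly P z)"
        by (simp add: norm_divide norm_power divide_le_eq mult_le_cancel_left1)
      also have "\<dots> \<le> max (cmod (poly P z)) \<epsilon>" by simp
      finally have "ln (cmod (poly P z / \<phi> z ^ n)) \<le> b z"
        unfolding b_def using nz phi_nonzero[OF that] \<open>\<epsilon> > 0\<close>
        by (subst ln_le_cancel_iff) (auto simp: less_max_iff_disj)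
      moreover have "0 < cmod (poly P z / \<phi> z ^ n)"
        using nz phi_nonzero[OF that] by simp
      then have "log_quotient P n (Some z) = ereal (ln (cmod (poly P z / \<phi> z ^ n)))"
        unfolding log_quotient_def elog_def option.case by (simp only: not_le[symmetric] if_False)
      ultimately show ?thesis by (simp only: ereal_less_eq)
    qed
    then have "Limsup (at \<zeta> within - K) (\<lambda>z. log_quotient P n (Some z))
        \<le> Limsup (at \<zeta> within - K) (\<lambda>z. ereal (b z))"
      by (intro Limsup_mono) (auto simp: eventually_at_filter)
    also have "\<dots> = ereal (b \<zeta>)"
    proof (rule lim_imp_Limsup[OF False])
      have "(b \<longlongrightarrow> b \<zeta>) (at \<zeta> within - K)"
        using contb continuous_on_eq_continuous_within[of UNIV b]
        by (auto simp: continuous_within intro: tendsto_within_subset)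
      then show "((\<lambda>z. ereal (b z)) \<longlongrightarrow> ereal (b \<zeta>)) (at \<zeta> within - K)"
        by (rule tendsto_ereal)
    qed
    finally show ?thesis .
  qed
  then have "log_quotient P n z0 \<le> perron K b z0"
    unfolding perron_def
    by (intro SUP_upper CollectI conjI ballI sphere_subharmonic_log_quotient assms)
  also have "\<dots> = ereal (set_lebesgue_integral \<omega> (frontier K) b)"
  proof -
    have "continuous_on (frontier K) b"
      using contb by (rule continuous_on_subset) simp
    then show ?thesis
      using assms(2) unfolding is_harmonic_measure_def by blast
  qed
  finally show ?thesis by (simp add: b_def[abs_def])
qed

end

section \<open>Jensen's inequality and the entropy integral\<close>

text \<open>Integrate the tangent line inequality \<open>exp m * (1 + (x - m)) \<le> exp x\<close> at the mean \<open>m\<close>.\<close>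

lemma exp_integral_le:
  assumes "prob_space M" and X: "integrable M X" and eX: "integrable M (\<lambda>x. exp (X x) :: real)"
  shows "exp (integral\<^sup>L M X) \<le> (LINT x|M. exp (X x))"
proof -
  interpret prob_space M by fact
  define m where "m = integral\<^sup>L M X"
  have "exp m = (LINT x|M. exp m * (1 + (X x - m)))"
    using X by (simp add: m_def prob_space)
  also have "\<dots> \<le> (LINT x|M. exp (X x))"
  proof (rule integral_mono)
    show "exp m * (1 + (X x - m)) \<le> exp (X x)" for x
      using mult_left_mono[OF exp_ge_add_one_self[of "X x - m"], of "exp m"]
      by (simp add: mult_exp_exp)
  qed (use X eX in auto)
  finally show ?thesis by (simp add: m_def)
qed

text \<open>As \<open>log x \<le> x\<close>, the positive part of \<open>log f\<close> is integrable. Hence the integral of \<open>log f\<close> is either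
  \<open>-\<infinity>\<close>, where the entropy integral vanishes, or an ordinary Lebesgue integral.\<close>

lemma entropy_integral_nonzeroD:
  assumes pos: "entropy_integral f \<omega> \<noteq> 0" and f: "integrable \<omega> f" "\<And>z. f z \<ge> 0"
  shows "AE z in \<omega>. f z > 0" "integrable \<omega> (\<lambda>z. ln (f z))"
    "entropy_integral f \<omega> = exp (LINT z|\<omega>. ln (f z))"
proof -
  have [measurable]: "f \<in> borel_measurable \<omega>" using f by auto
  have [measurable]: "(\<lambda>z. elog (f z)) \<in> borel_measurable \<omega>"
    unfolding elog_def by measurable
  let ?p = "\<integral>\<^sup>+z. e2ennreal (elog (f z)) \<partial>\<omega>" and ?m = "\<integral>\<^sup>+z. e2ennreal (- elog (f z)) \<partial>\<omega>"
  have "e2ennreal (elog (f z)) \<le> ennreal (f z)" for z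
    using ln_le_minus_one[of "f z"] by (auto simp: elog_def e2ennreal_neg intro!: ennreal_leI)
  then have "?p \<le> (\<integral>\<^sup>+z. ennreal (f z) \<partial>\<omega>)"
    by (intro nn_integral_mono)
  also have "\<dots> < \<infinity>"
    using f(1) by (auto simp: real_integrable_def less_top[symmetric])
  finally have p: "?p < \<infinity>" .
  have m: "?m < \<infinity>"
  proof (rule ccontr)
    assume "\<not> ?m < \<infinity>"
    then have "?m = \<infinity>" by (simp add: less_top[symmetric])
    moreover obtain x where "enn2ereal ?p = ereal x"
      using p by (cases "?p" rule: ennreal_cases) auto
    ultimately have "ereal_integral \<omega> (\<lambda>z. elog (f z)) = -\<infinity>"
      unfolding ereal_integral_def by simp
    then show False using pos by (simp add: entropy_integral_def)
  qed
  have "AE z in \<omega>. e2ennreal (- elog (f z)) \<noteq> \<infinity>"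
    using m by (intro nn_integral_noteq_infinite) auto
  then show AE: "AE z in \<omega>. f z > 0"
    by eventually_elim (auto simp: elog_def split: if_splits)
  have pe: "(\<integral>\<^sup>+z. ennreal (ln (f z)) \<partial>\<omega>) = ?p"
    using AE by (auto intro!: nn_integral_cong_AE elim!: eventually_mono simp: elog_def)
  have me: "(\<integral>\<^sup>+z. ennreal (- ln (f z)) \<partial>\<omega>) = ?m"
    using AE by (auto intro!: nn_integral_cong_AE elim!: eventually_mono simp: elog_def)
  show int: "integrable \<omega> (\<lambda>z. ln (f z))"
    unfolding real_integrable_def pe me using p m by auto
  have "ereal_integral \<omega> (\<lambda>z. elog (f z)) = ereal_integral \<omega> (\<lambda>z. ereal (ln (f z)))"
    unfolding ereal_integral_def using pe me by simp
  also have "\<dots> = ereal (LINT z|\<omega>. ln (f z))"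
    by (rule ereal_integral_ereal[OF int])
  finally show "entropy_integral f \<omega> = exp (LINT z|\<omega>. ln (f z))"
    by (simp add: entropy_integral_def)
qed

lemma entropy_integral_nonneg: "entropy_integral f \<omega> \<ge> 0"
  by (simp add: entropy_integral_def Let_def)

text \<open>Jensen's inequality for \<open>log f + log h\<close>. The bounds on \<open>h\<close> make \<open>log h\<close> and \<open>f h\<close> integrable.\<close>

lemma entropy_integral_mult_exp_le:
  assumes "prob_space \<omega>" and f: "integrable \<omega> f" "\<And>z. f z \<ge> 0"
    and h[measurable]: "h \<in> borel_measurable \<omega>" and "a > 0"
    and bnd: "\<And>z. a \<le> h z" "\<And>z. h z \<le> b"
  shows "entropy_integral f \<omega> * exp (LINT z|\<omega>. ln (h z)) \<le> (LINT z|\<omega>. f z * h z)"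
proof (cases "entropy_integral f \<omega> = 0")
  case True
  have "h z \<ge> 0" for z using bnd(1)[of z] \<open>a > 0\<close> by linarith
  then show ?thesis using True f(2) by (auto intro!: integral_nonneg_AE)
next
  case False
  interpret prob_space \<omega> by fact
  note E = entropy_integral_nonzeroD[OF False f]
  have hpos: "h z > 0" for z using bnd(1)[of z] \<open>a > 0\<close> by linarith
  have lnh: "integrable \<omega> (\<lambda>z. ln (h z))"
  proof (rule integrable_const_bound[where B = "max \<bar>ln a\<bar> \<bar>ln b\<bar>"])
    have "ln a \<le> ln (h z)" "ln (h z) \<le> ln b" for z
      using bnd[of z] hpos[of z] \<open>a > 0\<close> by auto
    then show "AE z in \<omega>. norm (ln (h z)) \<le> max \<bar>ln a\<bar> \<bar>ln b\<bar>"
      by (intro AE_I2) (smt (verit) real_norm_def)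
  qed simp
  have fh: "integrable \<omega> (\<lambda>z. f z * h z)"
  proof (rule Bochner_Integration.integrable_bound)
    show "integrable \<omega> (\<lambda>z. b * f z)" using f by simp
    show "AE z in \<omega>. norm (f z * h z) \<le> norm (b * f z)"
    proof (intro AE_I2)
      fix z
      have "f z * h z \<le> f z * b" using bnd f(2) by (intro mult_left_mono) auto
      then show "norm (f z * h z) \<le> norm (b * f z)"
        using f(2)[of z] hpos[of z] bnd(2)[of z] by (simp add: abs_mult mult.commute)
    qed
  qed (use f in auto)
  have AEe: "AE z in \<omega>. exp (ln (f z) + ln (h z)) = f z * h z"
    using E(1) by eventually_elim (use hpos in \<open>simp add: exp_add\<close>)
  have "integrable \<omega> (\<lambda>z. exp (ln (f z) + ln (h z)))"
    using fh AEe f by (subst integrable_cong_AE) auto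
  then have "exp (LINT z|\<omega>. ln (f z) + ln (h z)) \<le> (LINT z|\<omega>. exp (ln (f z) + ln (h z)))"
    using E(2) lnh by (intro exp_integral_le prob_space_axioms) auto
  also have "\<dots> = (LINT z|\<omega>. f z * h z)"
    using AEe f by (intro integral_cong_AE) auto
  finally show ?thesis
    using E(2,3) lnh by (simp add: exp_add)
qed

lemma integrable_density_part:
  assumes sets: "sets \<mu> = sets borel" "sets \<omega> = sets borel" and fin: "finite_measure \<mu>"
    and f: "f \<in> borel_measurable borel" "\<And>z. f z \<ge> 0"
    and le: "\<And>A. A \<in> sets borel \<Longrightarrow> emeasure (density \<omega> (\<lambda>z. ennreal (f z))) A \<le> emeasure \<mu> A"
    and g: "g \<in> borel_measurable borel" "\<And>z. g z \<ge> 0" "\<And>z. g z \<le> b"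
  shows "integrable \<omega> (\<lambda>z. f z * g z)" "(LINT z|\<omega>. f z * g z) \<le> (LINT z|\<mu>. g z :: real)"
proof -
  interpret \<mu>: finite_measure \<mu> by fact
  have m[measurable]: "f \<in> borel_measurable \<omega>" "g \<in> borel_measurable \<omega>" "g \<in> borel_measurable \<mu>"
    using f g sets by (auto simp: measurable_def sets_eq_imp_space_eq)
  have ig: "integrable \<mu> g"
    using g by (intro \<mu>.integrable_const_bound[where B = b]) auto
  have "(\<integral>\<^sup>+z. ennreal (f z * g z) \<partial>\<omega>) = (\<integral>\<^sup>+z. ennreal (g z) \<partial>density \<omega> (\<lambda>z. ennreal (f z)))"
    using f g by (subst nn_integral_density) (auto simp: ennreal_mult)
  also have "\<dots> \<le> (\<integral>\<^sup>+z. ennreal (g z) \<partial>\<mu>)"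
    using le sets by (intro nn_integral_mono_measure) (auto simp: le_measure)
  also have "\<dots> = ennreal (LINT z|\<mu>. g z)"
    using g ig by (intro nn_integral_eq_integral) auto
  finally have *: "(\<integral>\<^sup>+z. ennreal (f z * g z) \<partial>\<omega>) \<le> ennreal (LINT z|\<mu>. g z)" .
  then show "integrable \<omega> (\<lambda>z. f z * g z)"
    using f g by (intro integrableI_bounded) (auto simp: abs_mult intro: le_less_trans)
  show "(LINT z|\<omega>. f z * g z) \<le> (LINT z|\<mu>. g z)"
    using * g by (intro integral_real_bounded) (auto intro!: integral_nonneg_AE)
qed

text \<open>Jensen's inequality is applied with \<open>h = max(|P|, \<epsilon>)\<^sup>r\<close>. Since \<open>h \<le> |P|\<^sup>r + \<epsilon>\<^sup>r\<close>, passing from \<open>h\<close> to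
  \<open>|P|\<^sup>r\<close> costs at most \<open>\<epsilon>\<^sup>r \<integral> f d\<omega>\<close>, which is arbitrarily small.\<close>

lemma entropy_le_integral_power:
  fixes P :: "complex \<Rightarrow> complex"
  assumes K: "compact K" and P: "continuous_on UNIV P" and r: "r > 0"
    and \<omega>: "prob_space \<omega>" "sets \<omega> = sets borel" "emeasure \<omega> (- frontier K) = 0"
    and \<mu>: "sets \<mu> = sets borel" "finite_measure \<mu>"
    and f: "f \<in> borel_measurable borel" "\<And>z. f z \<ge> 0"
    and le: "\<And>A. A \<in> sets borel \<Longrightarrow> emeasure (density \<omega> (\<lambda>z. ennreal (f z))) A \<le> emeasure \<mu> A"
    and L: "\<And>\<epsilon>. \<epsilon> > 0 \<Longrightarrow>
      L \<le> set_lebesgue_integral \<omega> (frontier K) (\<lambda>z. ln (max (cmod (P z)) \<epsilon>))"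
  shows "entropy_integral f \<omega> * exp (r * L) \<le> set_lebesgue_integral \<mu> K (\<lambda>z. cmod (P z) powr r)"
proof -
  interpret prob_space \<omega> by fact
  have [measurable]: "P \<in> borel_measurable borel"
    using P by (rule borel_measurable_continuous_onI)
  have [measurable]: "K \<in> sets borel" "frontier K \<in> sets borel"
    using K by (auto intro!: borel_closed compact_imp_closed)
  have [measurable_cong]: "sets \<omega> = sets borel" by fact
  have "bounded (P ` K)"
    using K P by (intro compact_imp_bounded compact_continuous_image) (auto intro: continuous_on_subset)
  then obtain B where B: "\<And>z. z \<in> K \<Longrightarrow> cmod (P z) \<le> B"
    unfolding bounded_iff by auto
  define B' where "B' = max B 1"
  \<comment> \<open>Setting \<open>q\<close> to \<open>0\<close> off \<open>K\<close> makes it bounded on the whole plane without changing any of the integrals.\<close>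
  define q where "q z = (if z \<in> K then cmod (P z) else 0)" for z
  have q: "0 \<le> q z" "q z \<le> B'" for z
    using B by (auto simp: q_def B'_def intro: max.coboundedI1)
  have [measurable]: "q \<in> borel_measurable borel"
    unfolding q_def by measurable
  note dens = integrable_density_part[OF \<mu>(1) \<omega>(2) \<mu>(2) f le]
  have intf: "integrable \<omega> f"
    using dens(1)[of "\<lambda>_. 1" 1] by simp
  define F where "F = (LINT z|\<omega>. f z)"
  have "F \<ge> 0" using f unfolding F_def by (intro integral_nonneg_AE) auto
  have q_powr: "0 \<le> q z powr r" "q z powr r \<le> B' powr r" for z
    using q r by (auto intro: powr_mono2)
  have Q: "(LINT z|\<mu>. q z powr r) = set_lebesgue_integral \<mu> K (\<lambda>z. cmod (P z) powr r)"
    unfolding set_lebesgue_integral_def q_def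
    by (intro Bochner_Integration.integral_cong) (auto simp: indicator_def)
  have key: "entropy_integral f \<omega> * exp (r * L) \<le> (LINT z|\<mu>. q z powr r) + \<delta> * F" if "\<delta> > 0" for \<delta>
  proof -
    define \<epsilon> where "\<epsilon> = \<delta> powr (1 / r)"
    have \<epsilon>: "\<epsilon> > 0" "\<epsilon> powr r = \<delta>"
      using that r by (auto simp: \<epsilon>_def powr_powr)
    define h where "h z = max (q z) \<epsilon> powr r" for z
    have [measurable]: "h \<in> borel_measurable borel" unfolding h_def by measurable
    have h_le: "h z \<le> q z powr r + \<delta>" for z
      using \<epsilon> by (auto simp: h_def max_def)
    have AEfr: "AE z in \<omega>. z \<in> frontier K"
      using \<omega>(3) by (intro AE_I[of _ _ "- frontier K"]) auto
    have "set_lebesgue_integral \<omega> (frontier K) (\<lambda>z. ln (max (cmod (P z)) \<epsilon>)) =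
        (LINT z|\<omega>. ln (max (q z) \<epsilon>))"
      unfolding set_lebesgue_integral_def
    proof (rule integral_cong_AE)
      have frK: "frontier K \<subseteq> K" using K by (simp add: compact_imp_closed frontier_subset_closed)
      show "AE z in \<omega>. indicat_real (frontier K) z *\<^sub>R ln (max (cmod (P z)) \<epsilon>) = ln (max (q z) \<epsilon>)"
        using AEfr by eventually_elim (use frK in \<open>auto simp: q_def\<close>)
    qed measurable
    then have "r * L \<le> r * (LINT z|\<omega>. ln (max (q z) \<epsilon>))"
      using L[OF \<epsilon>(1)] r by simp
    also have "\<dots> = (LINT z|\<omega>. ln (h z))"
      using \<epsilon> by (simp add: h_def ln_powr)
    finally have "entropy_integral f \<omega> * exp (r * L) \<le> entropy_integral f \<omega> * exp (LINT z|\<omega>. ln (h z))"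
      by (intro mult_left_mono entropy_integral_nonneg) simp
    also have "\<dots> \<le> (LINT z|\<omega>. f z * h z)"
    proof (rule entropy_integral_mult_exp_le[OF \<omega>(1) intf f(2)])
      show "\<delta> \<le> h z" for z
        using r \<epsilon> by (auto simp: h_def simp flip: \<epsilon>(2) intro!: powr_mono2)
      show "h z \<le> B' powr r + \<delta>" for z
        using h_le[of z] q_powr(2)[of z] by linarith
    qed (use that in auto)
    also have "\<dots> \<le> (LINT z|\<omega>. f z * q z powr r + \<delta> * f z)"
    proof (rule integral_mono')
      show "integrable \<omega> (\<lambda>z. f z * q z powr r + \<delta> * f z)"
        using dens(1)[of "\<lambda>z. q z powr r" "B' powr r"] q_powr intf by simp
      show "f z * h z \<le> f z * q z powr r + \<delta> * f z" for z
        using mult_left_mono[OF h_le[of z] f(2)[of z]] by (simp add: algebra_simps)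
      show "0 \<le> f z * q z powr r + \<delta> * f z" for z
        using f(2) that by simp
    qed
    also have "\<dots> = (LINT z|\<omega>. f z * q z powr r) + \<delta> * F"
      using dens(1)[of "\<lambda>z. q z powr r" "B' powr r"] q_powr intf by (simp add: F_def)
    also have "\<dots> \<le> (LINT z|\<mu>. q z powr r) + \<delta> * F"
      using dens(2)[of "\<lambda>z. q z powr r" "B' powr r"] q_powr by simp
    finally show ?thesis .
  qed
  have "entropy_integral f \<omega> * exp (r * L) \<le> (LINT z|\<mu>. q z powr r)"
  proof (rule field_le_epsilon)
    fix e :: real assume "e > 0"
    have "e / (1 + F) * F \<le> e"
      using \<open>e > 0\<close> \<open>F \<ge> 0\<close> by (simp add: field_simps)
    then show "entropy_integral f \<omega> * exp (r * L) \<le> (LINT z|\<mu>. q z powr r) + e"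
      using key[of "e / (1 + F)"] \<open>e > 0\<close> \<open>F \<ge> 0\<close> by simp
  qed
  then show ?thesis by (simp add: Q)
qed

section \<open>The lower bound for the Christoffel function\<close>

theorem theorem1p2:
  fixes K :: "complex set" and z0 :: "complex option"
    and \<omega> \<mu> \<mu>s :: "complex measure" and f :: "complex \<Rightarrow> real"
    and n :: nat and r :: real
  assumes "compact K"
    and "log_capacity K > 0"
    and "simply_connected_space (subtopology riemann_sphere (exterior_domain K))"
    and "z0 \<in> exterior_domain K"
    and "is_harmonic_measure K z0 \<omega>"
    and "sets \<mu> = sets borel" and "finite_measure \<mu>" and "emeasure \<mu> (- K) = 0"
    and "sets \<mu>s = sets borel" and "mutually_singular \<mu>s \<omega>"
    and "f \<in> borel_measurable borel" and "\<And>z. f z \<ge> 0"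
    and "\<And>A. A \<in> sets borel \<Longrightarrow>
           emeasure \<mu> A = emeasure (density \<omega> (\<lambda>z. ennreal (f z))) A + emeasure \<mu>s A"
    and "r > 0"
  shows "christoffel K \<mu> z0 n r \<ge> entropy_integral f \<omega> * conformal_const K z0 powr (real n * r)"
proof -
  define \<Phi> where "\<Phi> = conformal_map K z0"
  have \<Phi>: "exterior_conformal_map K \<Phi>" "Im (normalizing_value \<Phi> z0) = 0" "Re (normalizing_value \<Phi> z0) > 0"
    using someI_ex[OF normalized_conformal_map_exists[OF assms(1-4)]]
    unfolding \<Phi>_def conformal_map_def by auto
  interpret exterior_conformal K \<Phi>
    using assms(1) \<Phi>(1) by unfold_locales
  define C where "C = conformal_const K z0"
  have C: "C = 1 / cmod (normalizing_value \<Phi> z0)" "C > 0"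
    using \<Phi>(2,3) by (auto simp: C_def conformal_const_def \<Phi>_def cmod_eq_Re)
  define \<P> where "\<P> = (case z0 of Some z \<Rightarrow> {P :: complex poly. degree P \<le> n \<and> poly P z = 1}
                        | None \<Rightarrow> {P. degree P = n \<and> lead_coeff P = 1})"
  have "\<P> \<noteq> {}"
  proof (cases z0)
    case None
    then have "monom 1 n \<in> \<P>" by (simp add: \<P>_def degree_monom_eq)
    then show ?thesis by auto
  next
    case (Some z)
    then have "1 \<in> \<P>" by (simp add: \<P>_def)
    then show ?thesis by auto
  qed
  have "entropy_integral f \<omega> * C powr (real n * r) \<le>
      set_lebesgue_integral \<mu> K (\<lambda>w. cmod (poly P w) powr r)" if P: "P \<in> \<P>" for P
  proof -
    have deg: "degree P \<le> n"
      using P by (auto simp: \<P>_def split: option.splits)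
    have "log_quotient P n z0 = elog (C ^ n)"
      using P C(1)
      by (auto simp: \<P>_def log_quotient_def normalizing_value_None normalizing_value_Some
           norm_divide norm_mult norm_power power_divide split: option.splits)
    also have "\<dots> = ereal (real n * ln C)"
      using C(2) by (simp add: elog_def ln_realpow not_le)
    finally have L: "real n * ln C \<le>
        set_lebesgue_integral \<omega> (frontier K) (\<lambda>z. ln (max (cmod (poly P z)) \<epsilon>))" if "\<epsilon> > 0" for \<epsilon>
      using log_quotient_le_integral[OF deg assms(5) that] by simp
    have "entropy_integral f \<omega> * exp (r * (real n * ln C)) \<le>
        set_lebesgue_integral \<mu> K (\<lambda>w. cmod (poly P w) powr r)"
      using assms(5) L
      by (intro entropy_le_integral_power assms(1,6,7,11,12,14) continuous_intros)
         (auto simp: is_harmonic_measure_def assms(13))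
    then show ?thesis
      using C(2) by (simp add: powr_def mult_ac)
  qed
  then show ?thesis
    unfolding christoffel_def C_def[symmetric] \<P>_def[symmetric]
    by (intro cINF_greatest \<open>\<P> \<noteq> {}\<close>)
qed

end
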